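(* Let $G=(V_G,E_G,\omega_G)$ be a finite undirected simple graph with positive integer edge weights, let $(\mathbb{L},\mathbb{G})$ be a vertex hierarchy of $G$, and for each $v\in V_G$ let $label(v)$ be the relaxed label of $v$ with entries $(u,d(v,u))$. For any $s,t\in V_G$, let $\mathbb{X}=\mathcal{V}[label(s)]\cap\mathcal{V}[label(t)]$. Then $$dist_G(s,t)=\begin{cases}\min_{w\in\mathbb{X}}\{d(s,w)+d(t,w)\} & \text{if } \mathbb{X}\neq\emptyset,\\ \infty & \text{if } \mathbb{X}=\emptyset.\end{cases}$$
   Context: For a finite weighted undirected simple graph $H=(V_H,E_H,\omega_H)$ with $\omega_H:E_H\to\mathbb{N}^+$: $adj_H(v)=\{u:(u,v)\in E_H\}$; the length of a path is the sum of its edge weights; $dist_H(u,v)$ is the minimum length of a path from $u$ to $v$ in $H$, with $dist_H(v,v)=0$ and $dist_H(u,v)=\infty$ if there is no path. Vertex hierarchy: a pair $(\mathbb{L},\mathbb{G})$ with $\mathbb{L}=\{L_1,\dots,L_h\}$ a family of vertex sets and $\mathbb{G}=\{G_1,\dots,G_h\}$ a family of weighted undirected simple graphs such that: (1) $V_G=L_1\cup\dots\cup L_h$ and $L_i\cap L_j=\emptyset$ for $i<j$; (2) for each $1\le i\le h$, $L_i$ is an independent set of $G_i$ (that is, $L_i\subseteq V_{G_i}$ and no two vertices of $L_i$ are adjacent in $G_i$); (3) $G_1=G$, and for $2\le i\le h$, $V_{G_i}=V_G\setminus(L_1\cup\dots\cup L_{i-1})$ and $G_i$ preserves distances with respect to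 $G_{i-1}$, i.e. $dist_{G_i}(u,v)=dist_{G_{i-1}}(u,v)$ for all $u,v\in V_{G_i}$. Level number: $\ell(v)=i$ iff $v\in L_i$. Relaxed label: for $v\in V_G$, $label(v)$ is a set of pairs $(u,d(v,u))$ computed as follows. Start with $label(v)=\{(v,0)\}$ and mark $v$. Repeat until no vertex is marked: take a marked vertex $u$ with smallest level number, unmark it, and let $j=\ell(u)$; for each $w\in adj_{G_j}(u)$ with $\ell(w)>j$: if $label(v)$ has no entry for $w$, add the entry $(w,d(v,u)+\omega_{G_j}(u,w))$ and mark $w$; if $label(v)$ already has an entry $(w,d(v,w))$, update $d(v,w)$ to $\min(d(v,w),d(v,u)+\omega_{G_j}(u,w))$. Vertex extraction: $\mathcal{V}[label(v)]=\{u:(u,d(v,u))\in label(v)\}$. *)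

theory Defs
  imports Main "HOL-Library.Extended_Nat"
begin

record 'a wgraph =
  verts :: "'a set"
  edges :: "'a set set"
  weight :: "'a set \<Rightarrow> nat"

text \<open>Edges are two-element vertex sets, so graphs are undirected and simple by construction.
  The values of the weight function outside the edge set are irrelevant.\<close>

definition weighted_graph :: "'a wgraph \<Rightarrow> bool" where
  "weighted_graph H \<longleftrightarrow>
     finite (verts H) \<and>
     (\<forall>e\<in>edges H. e \<subseteq> verts H \<and> card e = 2 \<and> weight H e > 0)"

definition adj :: "'a wgraph \<Rightarrow> 'a \<Rightarrow> 'a set" where
  "adj H v = {u. {u, v} \<in> edges H}"

definition is_path :: "'a wgraph \<Rightarrow> 'a \<Rightarrow> 'a list \<Rightarrow> 'a \<Rightarrow> bool" where
  "is_path H u p v \<longleftrightarrow>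
     p \<noteq> [] \<and> hd p = u \<and> last p = v \<and> set p \<subseteq> verts H \<and> distinct p \<and>
     successively (\<lambda>x y. {x, y} \<in> edges H) p"

fun path_length :: "'a wgraph \<Rightarrow> 'a list \<Rightarrow> nat" where
  "path_length H (x # y # p) = weight H {x, y} + path_length H (y # p)"
| "path_length H _ = 0"

text \<open>In \<^typ>\<open>enat\<close> the infimum of a nonempty set is its minimum, and the infimum of the empty
  set is \<open>\<infinity>\<close>. The path \<open>[v]\<close> gives distance \<open>0\<close> from \<open>v\<close> to itself.\<close>

definition gdist :: "'a wgraph \<Rightarrow> 'a \<Rightarrow> 'a \<Rightarrow> enat" where
  "gdist H u v = (INF p \<in> {p. is_path H u p v}. enat (path_length H p))"

definition independent_set :: "'a wgraph \<Rightarrow> 'a set \<Rightarrow> bool" where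
  "independent_set H I \<longleftrightarrow> I \<subseteq> verts H \<and> (\<forall>u\<in>I. \<forall>v\<in>I. v \<notin> adj H u)"

text \<open>Only the indices \<open>1, \<dots>, h\<close> of the families \<open>L\<close> and \<open>Gs\<close> are meaningful.\<close>

definition vertex_hierarchy ::
  "'a wgraph \<Rightarrow> nat \<Rightarrow> (nat \<Rightarrow> 'a set) \<Rightarrow> (nat \<Rightarrow> 'a wgraph) \<Rightarrow> bool" where
  "vertex_hierarchy G h L Gs \<longleftrightarrow>
     1 \<le> h \<and>
     (\<forall>i\<in>{1..h}. weighted_graph (Gs i)) \<and>
     verts G = (\<Union>i\<in>{1..h}. L i) \<and>
     (\<forall>i\<in>{1..h}. \<forall>j\<in>{1..h}. i < j \<longrightarrow> L i \<inter> L j = {}) \<and>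
     (\<forall>i\<in>{1..h}. independent_set (Gs i) (L i)) \<and>
     Gs 1 = G \<and>
     (\<forall>i\<in>{2..h}.
        verts (Gs i) = verts G - (\<Union>j\<in>{1..<i}. L j) \<and>
        (\<forall>u\<in>verts (Gs i). \<forall>v\<in>verts (Gs i). gdist (Gs i) u v = gdist (Gs (i - 1)) u v))"

definition level :: "nat \<Rightarrow> (nat \<Rightarrow> 'a set) \<Rightarrow> 'a \<Rightarrow> nat" where
  "level h L v = (THE i. i \<in> {1..h} \<and> v \<in> L i)"

text \<open>A label has at most one entry per vertex, so it is a partial map: \<open>l u = Some k\<close> stands
  for the entry \<open>(u, k)\<close>.\<close>

type_synonym 'a label = "'a \<rightharpoonup> nat"

definition label_verts :: "'a label \<Rightarrow> 'a set" where
  "label_verts l = dom l"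

definition higher_adj :: "nat \<Rightarrow> (nat \<Rightarrow> 'a set) \<Rightarrow> (nat \<Rightarrow> 'a wgraph) \<Rightarrow> 'a \<Rightarrow> 'a set" where
  "higher_adj h L Gs u = {w \<in> adj (Gs (level h L u)) u. level h L w > level h L u}"

text \<open>The entries of all neighbours of \<open>u\<close> can be updated simultaneously: each update reads only
  the entry of \<open>u\<close>, which is not itself updated, and the entry that it changes.\<close>

definition relax ::
  "nat \<Rightarrow> (nat \<Rightarrow> 'a set) \<Rightarrow> (nat \<Rightarrow> 'a wgraph) \<Rightarrow> 'a \<Rightarrow> 'a label \<Rightarrow> 'a label" where
  "relax h L Gs u l = (\<lambda>w.
     if w \<in> higher_adj h L Gs u then
       (let k = the (l u) + weight (Gs (level h L u)) {u, w} in
        case l w of None \<Rightarrow> Some k | Some k' \<Rightarrow> Some (min k' k))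
     else l w)"

text \<open>A state consists of the current label and the set of marked vertices. The step relation is
  nondeterministic, since several marked vertices may share the smallest level number.\<close>

inductive label_step ::
  "nat \<Rightarrow> (nat \<Rightarrow> 'a set) \<Rightarrow> (nat \<Rightarrow> 'a wgraph) \<Rightarrow>
   'a label \<times> 'a set \<Rightarrow> 'a label \<times> 'a set \<Rightarrow> bool"
  for h L Gs where
  "\<lbrakk>u \<in> M; \<And>x. x \<in> M \<Longrightarrow> level h L u \<le> level h L x\<rbrakk> \<Longrightarrow>
   label_step h L Gs (l, M)
     (relax h L Gs u l, (M - {u}) \<union> {w \<in> higher_adj h L Gs u. l w = None})"

text \<open>\<open>l\<close> is a possible final label of the procedure started at \<open>v\<close>.\<close>

definition relaxed_label ::
  "nat \<Rightarrow> (nat \<Rightarrow> 'a set) \<Rightarrow> (nat \<Rightarrow> 'a wgraph) \<Rightarrow> 'a \<Rightarrow> 'a label \<Rightarrow> bool" where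
  "relaxed_label h L Gs v l \<longleftrightarrow> (label_step h L Gs)\<^sup>*\<^sup>* ([v \<mapsto> 0], {v}) (l, {})"

lemma level_eq:
  assumes "vertex_hierarchy G h L Gs" "i \<in> {1..h}" "v \<in> L i"
  shows "level h L v = i"
  unfolding level_def
proof (rule the_equality)
  fix j assume j: "j \<in> {1..h} \<and> v \<in> L j"
  have "\<forall>i\<in>{1..h}. \<forall>j\<in>{1..h}. i < j \<longrightarrow> L i \<inter> L j = {}"
    using assms(1) unfolding vertex_hierarchy_def by simp
  then show "j = i" using j assms(2,3) by (cases i j rule: linorder_cases) blast+
qed (use assms in blast)

lemma higher_adj_subset:
  assumes "vertex_hierarchy G h L Gs" "u \<in> verts G"
  shows "higher_adj h L Gs u \<subseteq> verts G"
proof -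
  obtain i where i: "i \<in> {1..h}" "u \<in> L i"
    using assms unfolding vertex_hierarchy_def by auto
  have "verts (Gs i) \<subseteq> verts G"
  proof (cases "i = 1")
    case True
    then show ?thesis using assms(1) unfolding vertex_hierarchy_def by simp
  next
    case False
    then have "i \<in> {2..h}" using i(1) by auto
    then have "verts (Gs i) = verts G - (\<Union>j\<in>{1..<i}. L j)"
      using assms(1) unfolding vertex_hierarchy_def by blast
    then show ?thesis by blast
  qed
  moreover have "weighted_graph (Gs i)"
    using assms(1) i(1) unfolding vertex_hierarchy_def by simp
  ultimately have "e \<subseteq> verts G" if "e \<in> edges (Gs i)" for e
    using that unfolding weighted_graph_def by fast
  then show ?thesis
    unfolding higher_adj_def adj_def level_eq[OF assms(1) i] by auto
qed

text \<open>The procedure terminates, so every vertex has a relaxed label.\<close>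

lemma relaxed_label_exists:
  assumes hier: "vertex_hierarchy G h L Gs" and v: "v \<in> verts G"
  shows "\<exists>l. relaxed_label h L Gs v l"
proof -
  have fin: "finite (verts G)"
  proof -
    have "1 \<in> {1..h}" "Gs 1 = G" "\<forall>i\<in>{1..h}. weighted_graph (Gs i)"
      using hier unfolding vertex_hierarchy_def by simp_all
    then show ?thesis unfolding weighted_graph_def by metis
  qed
  have "M \<subseteq> dom l \<Longrightarrow> dom l \<subseteq> verts G \<Longrightarrow>
      \<exists>l'. (label_step h L Gs)\<^sup>*\<^sup>* (l, M) (l', {})" for l M
  proof (induction "2 * card (verts G - dom l) + card M" arbitrary: l M rule: less_induct)
    case less
    show ?case
    proof (cases "M = {}")
      case False
      have finM: "finite M" using less.prems fin by (meson finite_subset)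
      obtain u where u: "u \<in> M" "\<And>x. x \<in> M \<Longrightarrow> level h L u \<le> level h L x"
        using arg_min_if_finite(1)[OF finM False, of "level h L"]
          arg_min_least[OF finM False, of _ "level h L"] that by blast
      define N where "N = {w \<in> higher_adj h L Gs u. l w = None}"
      define l' where "l' = relax h L Gs u l"
      define M' where "M' = (M - {u}) \<union> N"
      have step: "label_step h L Gs (l, M) (l', M')"
        unfolding l'_def M'_def N_def using u by (intro label_step.intros)
      have N: "N \<subseteq> verts G - dom l"
        using higher_adj_subset[OF hier, of u] u less.prems unfolding N_def by auto
      have finN: "finite N" using N fin by (meson finite_Diff finite_subset)
      have dom: "dom l' = dom l \<union> N"
        unfolding l'_def N_def relax_def
        by (auto simp: Let_def split: if_splits option.splits)
      have "verts G - dom l' = (verts G - dom l) - N" unfolding dom by blast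
      then have "card (verts G - dom l') = card (verts G - dom l) - card N"
        using N finN by (simp add: card_Diff_subset)
      moreover have "card N \<le> card (verts G - dom l)"
        using N fin by (simp add: card_mono)
      moreover have "card M' \<le> card M - 1 + card N"
        unfolding M'_def using card_Un_le[of "M - {u}" N] u finM by simp
      moreover have "card M > 0" using finM False by (simp add: card_gt_0_iff)
      ultimately have "2 * card (verts G - dom l') + card M' < 2 * card (verts G - dom l) + card M"
        by linarith
      moreover have "M' \<subseteq> dom l'" "dom l' \<subseteq> verts G"
        using less.prems N unfolding dom M'_def by auto
      ultimately obtain l'' where "(label_step h L Gs)\<^sup>*\<^sup>* (l', M') (l'', {})"
        using less.hyps by blast
      with step show ?thesis by (meson converse_rtranclp_into_rtranclp)
    qed auto
  qed
  then show ?thesis using v unfolding relaxed_label_def by simp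
qed

end

theory Submission
  imports Defs
begin

text \<open>Upper bound on the distance: an edge of \<open>G\<^sub>j\<close> is at least as long as the distance of its
  ends in \<open>G\<close>, so every label entry \<open>d(v,u)\<close> is at least \<open>dist(v,u)\<close>. Lower bound: a label is
  closed under relaxation along edges towards higher levels. Given \<open>a\<close> in the label of \<open>s\<close> and
  \<open>b \<noteq> a\<close> in the label of \<open>t\<close>, say with \<open>j = \<ell>(a) \<le> \<ell>(b)\<close>, the first edge of a shortest path from
  \<open>a\<close> to \<open>b\<close> in \<open>G\<^sub>j\<close> leads to a higher level because \<open>L\<^sub>j\<close> is independent; replacing \<open>a\<close> by the
  end of that edge does not increase \<open>d(s,a) + dist(a,b) + d(t,b)\<close>. Repeating this, starting
  from \<open>a = s\<close> and \<open>b = t\<close>, the two vertices climb until they coincide.\<close>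

section \<open>Distances in weighted graphs\<close>

lemma is_path_Cons_Cons:
  "is_path H u (x # y # p) v \<longleftrightarrow>
     x = u \<and> {u, y} \<in> edges H \<and> u \<in> verts H \<and> u \<notin> set (y # p) \<and> is_path H y (y # p) v"
  by (auto simp: is_path_def)

lemma is_path_singleton: "is_path H u [x] v \<longleftrightarrow> x = u \<and> v = u \<and> u \<in> verts H"
  by (auto simp: is_path_def)

lemma gdist_le_path: "is_path H u p v \<Longrightarrow> gdist H u v \<le> enat (path_length H p)"
  unfolding gdist_def by (rule INF_lower) simp

lemma gdist_attained:
  assumes "gdist H u v = enat n"
  obtains p where "is_path H u p v" "path_length H p = n"
proof -
  let ?A = "(\<lambda>p. enat (path_length H p)) ` {p. is_path H u p v}"
  \<comment> \<open>The infimum of the empty set would be infinity, not \<open>enat n\<close>;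
    \<open>enat\<close> is a well-order, so a nonempty set contains its infimum.\<close>
  have "?A \<noteq> {}"
    using assms unfolding gdist_def by (metis Inf_empty enat.distinct(1) top_enat_def)
  then have "Inf ?A \<in> ?A" by (meson ex_in_conv wellorder_InfI)
  then show ?thesis using assms that unfolding gdist_def by auto
qed

lemma gdist_refl: "u \<in> verts H \<Longrightarrow> gdist H u u = 0"
  using gdist_le_path[of H u "[u]" u] by (simp add: is_path_singleton zero_enat_def[symmetric])

lemma edge_neq: "weighted_graph H \<Longrightarrow> {u, v} \<in> edges H \<Longrightarrow> u \<noteq> v"
  unfolding weighted_graph_def by fastforce

lemma edge_verts: "weighted_graph H \<Longrightarrow> {u, v} \<in> edges H \<Longrightarrow> u \<in> verts H \<and> v \<in> verts H"
  unfolding weighted_graph_def by fast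

lemma gdist_le_edge:
  assumes "weighted_graph H" "{u, v} \<in> edges H"
  shows "gdist H u v \<le> enat (weight H {u, v})"
  using gdist_le_path[of H u "[u, v]" v] edge_neq[OF assms] edge_verts[OF assms] assms(2)
  by (simp add: is_path_Cons_Cons is_path_singleton)

lemma path_length_append: "path_length H p \<le> path_length H (q @ p)"
proof (induction q)
  case (Cons x q)
  then show ?case by (cases "q @ p") auto
qed simp

text \<open>Prepending \<open>u\<close> to a shortest path from \<open>x\<close> yields a path only
  if \<open>u\<close> is new to it, since paths have distinct vertices. Otherwise the part of that
  path starting at \<open>u\<close> is already short enough.\<close>

lemma gdist_edge_triangle:
  assumes wg: "weighted_graph H" and e: "{u, x} \<in> edges H"
  shows "gdist H u w \<le> enat (weight H {u, x}) + gdist H x w"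
proof (cases "gdist H x w")
  case (enat n)
  then obtain p where p: "is_path H x p w" "path_length H p = n"
    by (rule gdist_attained)
  show ?thesis
  proof (cases "u \<in> set p")
    case True
    then obtain q r where qr: "p = q @ u # r" by (meson split_list)
    then have "is_path H u (u # r) w"
      using p(1) by (auto simp: is_path_def successively_append_iff)
    then have "gdist H u w \<le> enat (path_length H (u # r))" by (rule gdist_le_path)
    also have "\<dots> \<le> enat (path_length H p)" unfolding qr using path_length_append by simp
    also have "\<dots> \<le> enat (weight H {u, x}) + gdist H x w" using p(2) enat by simp
    finally show ?thesis .
  next
    case False
    obtain p' where p': "p = x # p'" using p(1) unfolding is_path_def by (cases p) auto
    then have "is_path H u (u # p) w"
      using False p(1) e edge_verts[OF wg e] by (simp add: is_path_Cons_Cons)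
    then have "gdist H u w \<le> enat (path_length H (u # p))" by (rule gdist_le_path)
    also have "\<dots> = enat (weight H {u, x}) + gdist H x w" using p(2) p' enat by simp
    finally show ?thesis .
  qed
qed simp

text \<open>Prepending the edges of \<open>p\<close> one at a time avoids concatenating two paths,
  which need not give a path with distinct vertices.\<close>

lemma gdist_path_triangle:
  assumes wg: "weighted_graph H"
  shows "is_path H u p v \<Longrightarrow> gdist H u w \<le> enat (path_length H p) + gdist H v w"
proof (induction p arbitrary: u rule: induct_list012)
  case 1
  then show ?case by (simp add: is_path_def)
next
  case (2 x)
  then show ?case by (simp add: is_path_singleton zero_enat_def[symmetric])
next
  case (3 x y p)
  then have e: "x = u" "{u, y} \<in> edges H" and p: "is_path H y (y # p) v"
    by (auto simp: is_path_Cons_Cons)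
  have "gdist H u w \<le> enat (weight H {u, y}) + gdist H y w"
    by (rule gdist_edge_triangle[OF wg e(2)])
  also have "\<dots> \<le> enat (weight H {u, y}) + (enat (path_length H (y # p)) + gdist H v w)"
    by (intro add_left_mono 3 p)
  finally show ?case using e(1) by (simp add: add.assoc[symmetric])
qed

lemma gdist_triangle:
  assumes "weighted_graph H"
  shows "gdist H u w \<le> gdist H u v + gdist H v w"
proof (cases "gdist H u v")
  case (enat n)
  then obtain p where "is_path H u p v" "path_length H p = n" by (rule gdist_attained)
  then show ?thesis using gdist_path_triangle[OF assms] enat by metis
qed simp

lemma is_path_rev: "is_path H u p v \<Longrightarrow> is_path H v (rev p) u"
  by (auto simp: is_path_def hd_rev last_rev insert_commute)

lemma path_length_snoc:
  "path_length H (p @ [x, y]) = path_length H (p @ [x]) + weight H {x, y}"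
  by (induction p rule: induct_list012) auto

lemma path_length_rev: "path_length H (rev p) = path_length H p"
proof (induction p rule: induct_list012)
  case (3 x y p)
  then show ?case using path_length_snoc[of H "rev p" y x] by (simp add: insert_commute)
qed auto

lemma gdist_commute: "gdist H u v = gdist H v u"
proof -
  have "gdist H u v \<le> gdist H v u" for u v
    unfolding gdist_def[of H v u]
    using gdist_le_path[OF is_path_rev] by (auto intro!: INF_greatest simp: path_length_rev)
  then show ?thesis by (simp add: antisym)
qed

section \<open>Vertex hierarchies\<close>

locale hierarchy =
  fixes G :: "'a wgraph" and h :: nat and L :: "nat \<Rightarrow> 'a set" and Gs :: "nat \<Rightarrow> 'a wgraph"
  assumes hier: "vertex_hierarchy G h L Gs"
begin

abbreviation "lev \<equiv> level h L"

lemma Gs_1: "Gs 1 = G" and h_ge_1: "1 \<le> h"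
  using hier unfolding vertex_hierarchy_def by blast+

lemma weighted_graph_Gs: "i \<in> {1..h} \<Longrightarrow> weighted_graph (Gs i)"
  using hier unfolding vertex_hierarchy_def by simp

lemma weighted_graph_G: "weighted_graph G"
  using weighted_graph_Gs[of 1] Gs_1 h_ge_1 by simp

lemma verts_Gs:
  assumes "i \<in> {1..h}"
  shows "verts (Gs i) = verts G - (\<Union>j\<in>{1..<i}. L j)"
proof (cases "i = 1")
  case True
  then show ?thesis using Gs_1 by simp
next
  case False
  then have "i \<in> {2..h}" using assms by auto
  then show ?thesis using hier unfolding vertex_hierarchy_def by blast
qed

lemma level_in:
  assumes "v \<in> verts G"
  shows "lev v \<in> {1..h}" "v \<in> L (lev v)"
proof -
  obtain i where i: "i \<in> {1..h}" "v \<in> L i"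
    using hier assms unfolding vertex_hierarchy_def by auto
  then show "lev v \<in> {1..h}" "v \<in> L (lev v)" using level_eq[OF hier i] by auto
qed

lemma mem_verts_Gs:
  assumes "i \<in> {1..h}"
  shows "v \<in> verts (Gs i) \<longleftrightarrow> v \<in> verts G \<and> i \<le> lev v"
proof (cases "v \<in> verts G")
  case True
  have "(\<exists>j\<in>{1..<i}. v \<in> L j) \<longleftrightarrow> lev v < i"
  proof
    assume "\<exists>j\<in>{1..<i}. v \<in> L j"
    then show "lev v < i" using level_eq[OF hier] assms by force
  next
    assume "lev v < i"
    then show "\<exists>j\<in>{1..<i}. v \<in> L j" using level_in[OF True] by auto
  qed
  then show ?thesis using True verts_Gs[OF assms] by auto
next
  case False
  then show ?thesis using verts_Gs[OF assms] by auto
qed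

text \<open>The vertex sets shrink as the index grows, so \<open>u\<close> and \<open>v\<close> lie
  in all earlier graphs too and the stepwise preservation of distances chains down to
  \<open>Gs 1 = G\<close>.\<close>

lemma gdist_Gs:
  assumes "i \<in> {1..h}" "u \<in> verts (Gs i)" "v \<in> verts (Gs i)"
  shows "gdist (Gs i) u v = gdist G u v"
  using assms
proof (induction i)
  case (Suc i)
  show ?case
  proof (cases "i = 0")
    case True
    then show ?thesis using Gs_1 by simp
  next
    case False
    then have i: "Suc i \<in> {2..h}" "i \<in> {1..h}" using Suc.prems by auto
    then have "gdist (Gs (Suc i)) u v = gdist (Gs i) u v"
      using hier Suc.prems unfolding vertex_hierarchy_def by force
    also have "\<dots> = gdist G u v"
      using Suc i mem_verts_Gs by force
    finally show ?thesis .
  qed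
qed simp

lemma higher_adj_edge:
  assumes "u \<in> verts G" "w \<in> higher_adj h L Gs u"
  shows "{u, w} \<in> edges (Gs (lev u))" "w \<in> verts G" "lev u < lev w"
  using assms higher_adj_subset[OF hier] unfolding higher_adj_def adj_def
  by (auto simp: insert_commute)

text \<open>Vertices of \<open>Gs (lev u)\<close> have level at least \<open>lev u\<close>, and
  independence of \<open>L (lev u)\<close> excludes equality.\<close>

lemma adj_imp_higher_adj:
  assumes "u \<in> verts G" "{u, w} \<in> edges (Gs (lev u))"
  shows "w \<in> higher_adj h L Gs u"
proof -
  note lu = level_in[OF assms(1)]
  have w: "w \<in> verts (Gs (lev u))"
    using edge_verts[OF weighted_graph_Gs[OF lu(1)] assms(2)] by blast
  have adj: "w \<in> adj (Gs (lev u)) u"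
    using assms(2) by (simp add: adj_def insert_commute)
  have "independent_set (Gs (lev u)) (L (lev u))"
    using hier lu unfolding vertex_hierarchy_def by blast
  then have "w \<notin> L (lev u)"
    using adj lu unfolding independent_set_def by blast
  then have "lev w \<noteq> lev u"
    using level_in w mem_verts_Gs[OF lu(1)] by metis
  then show ?thesis
    using adj w mem_verts_Gs[OF lu(1)] unfolding higher_adj_def by auto
qed

lemma gdist_le_up_edge:
  assumes "u \<in> verts G" "w \<in> higher_adj h L Gs u"
  shows "gdist G u w \<le> enat (weight (Gs (lev u)) {u, w})"
proof -
  note lu = level_in(1)[OF assms(1)]
  note e = higher_adj_edge(1)[OF assms]
  show ?thesis
    using gdist_le_edge[OF weighted_graph_Gs[OF lu] e] gdist_Gs[OF lu]
      edge_verts[OF weighted_graph_Gs[OF lu] e] by simp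
qed

section \<open>Invariants of the labelling procedure\<close>

text \<open>The fixed-point condition: processing \<open>u\<close> once more would leave
  \<open>l\<close> unchanged.\<close>

definition relaxed_at :: "'a label \<Rightarrow> 'a \<Rightarrow> bool" where
  "relaxed_at l u \<longleftrightarrow> (\<forall>w\<in>higher_adj h L Gs u.
     w \<in> dom l \<and> the (l w) \<le> the (l u) + weight (Gs (lev u)) {u, w})"

text \<open>The last clause makes sure that the entry of an unmarked vertex never changes again: an
  update only affects levels above that of the processed vertex.\<close>

definition label_inv :: "'a \<Rightarrow> 'a label \<times> 'a set \<Rightarrow> bool" where
  "label_inv v = (\<lambda>(l, M).
     M \<subseteq> dom l \<and> dom l \<subseteq> verts G \<and> l v = Some 0 \<and>
     (\<forall>x\<in>dom l. gdist G v x \<le> enat (the (l x))) \<and>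
     (\<forall>x\<in>dom l - M. relaxed_at l x) \<and>
     (\<forall>x\<in>dom l - M. \<forall>y\<in>M. lev x \<le> lev y))"

text \<open>The processed vertex \<open>u\<close> has minimal level among the marked ones, so by the
  last clause of the invariant every unmarked entry lies at level at most \<open>lev u\<close>,
  where nothing is changed.\<close>

lemma label_inv_step:
  assumes "label_step h L Gs S S'" "label_inv v S"
  shows "label_inv v S'"
  using assms
proof cases
  case (1 u M l)
  define l' where "l' = relax h L Gs u l"
  define M' where "M' = M - {u} \<union> {w \<in> higher_adj h L Gs u. l w = None}"
  from assms(2) 1 have inv: "M \<subseteq> dom l" "dom l \<subseteq> verts G" "l v = Some 0"
    and dist: "\<And>x. x \<in> dom l \<Longrightarrow> gdist G v x \<le> enat (the (l x))"
    and rel: "\<And>x. x \<in> dom l - M \<Longrightarrow> relaxed_at l x"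
    and lev: "\<And>x y. x \<in> dom l - M \<Longrightarrow> y \<in> M \<Longrightarrow> lev x \<le> lev y"
    unfolding label_inv_def by auto
  have u: "u \<in> dom l" "u \<in> verts G" using 1 inv by auto
  have dom: "dom l' = dom l \<union> higher_adj h L Gs u"
    unfolding l'_def relax_def by (auto simp: Let_def split: if_splits option.splits)
  have low: "l' x = l x" if "lev x \<le> lev u" for x
    using that higher_adj_edge(3)[OF u(2)] unfolding l'_def relax_def by force
  have mono: "the (l' x) \<le> the (l x)" if "x \<in> dom l" for x
    using that unfolding l'_def relax_def by (auto simp: Let_def)
  have upd: "the (l' w) \<le> the (l u) + weight (Gs (lev u)) {u, w}"
    if "w \<in> higher_adj h L Gs u" for w
    using that unfolding l'_def relax_def by (auto simp: Let_def split: option.splits)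
  \<comment> \<open>Taking the minimum selects either the old value or the candidate through
    \<open>u\<close>, so the distance bound can be checked on each alone.\<close>
  have vals: "x \<in> dom l \<and> the (l' x) = the (l x) \<or>
      x \<in> higher_adj h L Gs u \<and> the (l' x) = the (l u) + weight (Gs (lev u)) {u, x}"
    if "x \<in> dom l'" for x
    using that unfolding l'_def relax_def
    by (auto simp: Let_def min_def split: if_splits option.splits)
  \<comment> \<open>Every new entry gets marked, so \<open>u\<close> is the only vertex that can
    have become unmarked.\<close>
  have unmarked: "x \<in> dom l \<and> lev x \<le> lev u \<and> (x \<in> dom l - M \<or> x = u)"
    if "x \<in> dom l' - M'" for x
    using that lev[of x u] \<open>u \<in> M\<close> u(1) unfolding dom M'_def by auto
  have "M' \<subseteq> dom l'" using inv unfolding M'_def dom by auto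
  moreover have "dom l' \<subseteq> verts G"
    using inv higher_adj_subset[OF hier u(2)] unfolding dom by auto
  moreover have "l' v = Some 0"
    using inv unfolding l'_def relax_def by (simp add: Let_def)
  moreover have "gdist G v x \<le> enat (the (l' x))" if x: "x \<in> dom l'" for x
    using vals[OF x]
  proof (elim disjE conjE)
    assume "x \<in> dom l" "the (l' x) = the (l x)"
    then show ?thesis using dist by metis
  next
    assume w: "x \<in> higher_adj h L Gs u"
      and eq: "the (l' x) = the (l u) + weight (Gs (lev u)) {u, x}"
    have "gdist G v x \<le> gdist G v u + gdist G u x"
      by (rule gdist_triangle[OF weighted_graph_G])
    also have "\<dots> \<le> enat (the (l u)) + enat (weight (Gs (lev u)) {u, x})"
      by (intro add_mono dist u gdist_le_up_edge w)
    finally show ?thesis using eq by simp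
  qed
  moreover have "relaxed_at l' x" if x: "x \<in> dom l' - M'" for x
  proof -
    note ux = unmarked[OF x]
    have eq: "l' x = l x" using low ux by blast
    show ?thesis
    proof (cases "x = u")
      case True
      then show ?thesis using upd eq unfolding relaxed_at_def dom by auto
    next
      \<comment> \<open>The entry of \<open>x\<close> is frozen while those of its higher neighbours
        can only decrease, so \<open>x\<close> stays relaxed.\<close>
      case False
      then have "relaxed_at l x" using rel ux by blast
      then show ?thesis
        using mono eq order_trans unfolding relaxed_at_def dom by fastforce
    qed
  qed
  moreover have "lev x \<le> lev y" if "x \<in> dom l' - M'" "y \<in> M'" for x y
  proof -
    have "lev u \<le> lev y"
      using that(2) 1 higher_adj_edge(3)[OF u(2), of y] unfolding M'_def by auto
    then show ?thesis using unmarked[OF that(1)] by linarith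
  qed
  ultimately show ?thesis
    using 1 unfolding label_inv_def l'_def[symmetric] M'_def[symmetric] by auto
qed

text \<open>Once no vertex is marked, the invariant says that the whole label is relaxed.\<close>

lemma label_inv_relaxed_label:
  assumes "relaxed_label h L Gs v l" "v \<in> verts G"
  shows "label_inv v (l, {})"
proof -
  have "label_inv v ([v \<mapsto> 0], {v})"
    using assms(2) gdist_refl[OF assms(2)] unfolding label_inv_def by auto
  moreover have "label_inv v S'" if "(label_step h L Gs)\<^sup>*\<^sup>* S S'" "label_inv v S" for S S'
    using that by (induction rule: rtranclp_induct) (auto intro: label_inv_step)
  ultimately show ?thesis using assms(1) unfolding relaxed_label_def by blast
qed

section \<open>Meeting vertices\<close>

lemma up_step:
  assumes l: "dom l \<subseteq> verts G" "\<And>x. x \<in> dom l \<Longrightarrow> relaxed_at l x"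
    and a: "a \<in> dom l" and b: "b \<in> verts G" "a \<noteq> b" "lev a \<le> lev b"
    and D: "gdist G a b = enat D"
  obtains x D' where "x \<in> dom l" "lev a < lev x" "gdist G x b = enat D'"
    "the (l x) + D' \<le> the (l a) + D"
proof -
  let ?H = "Gs (lev a)"
  have aG: "a \<in> verts G" using a l by blast
  note la = level_in(1)[OF aG]
  have ab: "a \<in> verts ?H" "b \<in> verts ?H" using mem_verts_Gs[OF la] aG b by auto
  then have "gdist ?H a b = enat D" using D gdist_Gs[OF la] by simp
  then obtain p where p: "is_path ?H a p b" "path_length ?H p = D" by (rule gdist_attained)
  obtain x q where q: "p = a # x # q"
  \<comment> \<open>The rule serves only to split lists into empty, singleton and longer ones; a
    singleton would force \<open>a = b\<close>.\<close>
  proof (cases p rule: remdups_adj.cases[case_names Nil single Cons])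
    case Nil
    then show ?thesis using p by (simp add: is_path_def)
  next
    case (single y)
    then show ?thesis using p b by (simp add: is_path_singleton)
  next
    case (Cons y z q)
    then show ?thesis using p that by (simp add: is_path_Cons_Cons)
  qed
  then have e: "{a, x} \<in> edges ?H" and q': "is_path ?H x (x # q) b"
    using p(1) by (auto simp: is_path_Cons_Cons)
  have x: "x \<in> higher_adj h L Gs a" by (rule adj_imp_higher_adj[OF aG e])
  have "x \<in> verts ?H" using q' by (simp add: is_path_def)
  \<comment> \<open>The rest of the path still runs in \<open>?H\<close>, whose distances agree with
    those of \<open>G\<close>.\<close>
  then have le: "gdist G x b \<le> enat (path_length ?H (x # q))"
    using gdist_le_path[OF q'] gdist_Gs[OF la] ab by simp
  then obtain D' where D': "gdist G x b = enat D'" by (cases "gdist G x b") auto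
  have "x \<in> dom l" "the (l x) \<le> the (l a) + weight ?H {a, x}"
    using l(2)[OF a] x unfolding relaxed_at_def by auto
  moreover have "weight ?H {a, x} + D' \<le> D" using p(2) le D' unfolding q by simp
  ultimately show ?thesis using that D' higher_adj_edge(3)[OF aG x] by fastforce
qed

lemma common_entry:
  assumes l: "dom l \<subseteq> verts G" "\<And>x. x \<in> dom l \<Longrightarrow> relaxed_at l x"
    and m: "dom m \<subseteq> verts G" "\<And>x. x \<in> dom m \<Longrightarrow> relaxed_at m x"
  shows "a \<in> dom l \<Longrightarrow> b \<in> dom m \<Longrightarrow> gdist G a b = enat D \<Longrightarrow>
    \<exists>w \<in> dom l \<inter> dom m. the (l w) + the (m w) \<le> the (l a) + the (m b) + D"
\<comment> \<open>Levels are bounded by \<open>h\<close>, so the measure strictly drops whenever one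
  of the two vertices climbs.\<close>
proof (induction "(h - lev a) + (h - lev b)" arbitrary: a b D rule: less_induct)
  case less
  have ab: "a \<in> verts G" "b \<in> verts G" using less.prems l m by auto
  have hab: "lev x \<le> h" if "x \<in> verts G" for x using level_in(1)[OF that] by simp
  consider "a = b" | "a \<noteq> b" "lev a \<le> lev b" | "b \<noteq> a" "lev b \<le> lev a"
    by (metis nat_le_linear)
  then show ?case
  proof cases
    case 1
    then have "the (l a) + the (m a) \<le> the (l a) + the (m b) + D" by simp
    then show ?thesis using less.prems 1 by blast
  next
    case 2
    obtain x D' where x: "x \<in> dom l" "lev a < lev x" "gdist G x b = enat D'"
      "the (l x) + D' \<le> the (l a) + D"
      by (rule up_step[OF l less.prems(1) ab(2) 2 less.prems(3)])
    have "lev x \<le> h" using hab x(1) l(1) by blast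
    then have "(h - lev x) + (h - lev b) < (h - lev a) + (h - lev b)" using x(2) by linarith
    from less.hyps[OF this x(1) less.prems(2) x(3)] obtain w where
      "w \<in> dom l \<inter> dom m" "the (l w) + the (m w) \<le> the (l x) + the (m b) + D'" by blast
    moreover from this x(4) have "the (l w) + the (m w) \<le> the (l a) + the (m b) + D" by linarith
    ultimately show ?thesis by blast
  next
    case 3
    \<comment> \<open>The graph is undirected, so \<open>b\<close> can climb towards
      \<open>a\<close> with the two labels exchanging roles.\<close>
    have ba: "gdist G b a = enat D" using less.prems(3) by (simp add: gdist_commute)
    obtain x D' where x: "x \<in> dom m" "lev b < lev x" "gdist G x a = enat D'"
      "the (m x) + D' \<le> the (m b) + D"
      by (rule up_step[OF m less.prems(2) ab(1) 3 ba])
    have ax: "gdist G a x = enat D'" using x(3) by (simp add: gdist_commute)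
    have "lev x \<le> h" using hab x(1) m(1) by blast
    then have "(h - lev a) + (h - lev x) < (h - lev a) + (h - lev b)" using x(2) by linarith
    from less.hyps[OF this less.prems(1) x(1) ax] obtain w where
      "w \<in> dom l \<inter> dom m" "the (l w) + the (m w) \<le> the (l a) + the (m x) + D'" by blast
    moreover from this x(4) have "the (l w) + the (m w) \<le> the (l a) + the (m b) + D" by linarith
    ultimately show ?thesis by blast
  qed
qed

end

theorem theorem2:
  fixes G :: "'a wgraph"
    and h :: nat
    and L :: "nat \<Rightarrow> 'a set"
    and Gs :: "nat \<Rightarrow> 'a wgraph"
    and label :: "'a \<Rightarrow> 'a label"
    and s t :: 'a
    and X :: "'a set"
  assumes "weighted_graph G"
    and "vertex_hierarchy G h L Gs"
    and "\<forall>v\<in>verts G. relaxed_label h L Gs v (label v)"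
    and "s \<in> verts G" and "t \<in> verts G"
    and "X = label_verts (label s) \<inter> label_verts (label t)"
  shows "gdist G s t =
    (if X \<noteq> {} then enat (MIN w\<in>X. the (label s w) + the (label t w)) else \<infinity>)"
proof -
  interpret hierarchy G h L Gs by unfold_locales (rule assms(2))
  define l where "l = label s"
  define m where "m = label t"
  have "label_inv s (l, {})" "label_inv t (m, {})"
    using label_inv_relaxed_label assms(3-5) unfolding l_def m_def by auto
  then have l: "dom l \<subseteq> verts G" "\<And>x. x \<in> dom l \<Longrightarrow> relaxed_at l x" "l s = Some 0"
      "\<And>x. x \<in> dom l \<Longrightarrow> gdist G s x \<le> enat (the (l x))"
    and m: "dom m \<subseteq> verts G" "\<And>x. x \<in> dom m \<Longrightarrow> relaxed_at m x" "m t = Some 0"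
      "\<And>x. x \<in> dom m \<Longrightarrow> gdist G t x \<le> enat (the (m x))"
    unfolding label_inv_def by auto
  have X: "X = dom l \<inter> dom m"
    using assms(6) unfolding label_verts_def l_def m_def .
  have upper: "gdist G s t \<le> enat (the (l w) + the (m w))" if "w \<in> X" for w
  proof -
    have "gdist G s t \<le> gdist G s w + gdist G w t" by (rule gdist_triangle[OF assms(1)])
    also have "\<dots> \<le> enat (the (l w)) + enat (the (m w))"
      using that l(4) m(4) unfolding X gdist_commute[of G w t] by (intro add_mono) auto
    finally show ?thesis by simp
  qed
  \<comment> \<open>The climb starts at \<open>s\<close> and \<open>t\<close> themselves, whose own
    entries are 0. In particular, a finite distance forces \<open>X\<close> to be nonempty.\<close>
  have lower: "\<exists>w\<in>X. the (l w) + the (m w) \<le> D" if "gdist G s t = enat D" for D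
    using common_entry[OF l(1,2) m(1,2) _ _ that] l(3) m(3) unfolding X by auto
  show ?thesis
  proof (cases "X = {}")
    case True
    then show ?thesis using lower by (cases "gdist G s t") auto
  next
    case False
    let ?f = "\<lambda>w. the (l w) + the (m w)"
    have fin: "finite (?f ` X)"
      using X l(1) assms(1) unfolding weighted_graph_def
      by (meson finite_Int finite_imageI finite_subset)
    then have "Min (?f ` X) \<in> ?f ` X" using False by simp
    \<comment> \<open>Besides giving one inequality, this makes the distance finite, as
      \<open>lower\<close> requires.\<close>
    then have ub: "gdist G s t \<le> enat (Min (?f ` X))" using upper by auto
    then obtain D where D: "gdist G s t = enat D" by (cases "gdist G s t") auto
    obtain w where "w \<in> X" "?f w \<le> D" using lower[OF D] by blast
    then have "Min (?f ` X) \<le> D" using Min_le[OF fin] by (meson imageI order_trans)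
    then have "gdist G s t = enat (Min (?f ` X))" using ub D by simp
    then show ?thesis using False unfolding l_def m_def by simp
  qed
qed

end
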